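(* Let $\theta>0$, let $A_i,\alpha_i>0$, $a_i\ge0$ for $i=1,\dots,p$ and $B_j,\beta_j>0$, $b_j\ge0$ for $j=1,\dots,s$. Suppose that $$\sum_{i=1}^p\alpha_iA_i=\sum_{j=1}^s\beta_jB_j,\qquad \prod_{i=1}^pA_i^{\alpha_iA_i}\prod_{j=1}^sB_j^{-\beta_jB_j}\le\theta,$$ and $$(b_j-1)\sum_{k=1}^s\beta_kB_k\ge B_j\sum_{i=1}^p\alpha_ia_i\quad\text{for } j=1,\dots,s.$$ Then the function $$V(x)=\theta^{-x}\frac{\prod_{i=1}^p\Gamma(A_ix+a_i)^{\alpha_i}}{\prod_{j=1}^s\Gamma(B_jx+b_j)^{\beta_j}},\qquad x>0,$$ is logarithmically completely monotonic.
   Context: $\Gamma$ is Euler's gamma function. A function $f:(0,\infty)\to\mathbb R$ is completely monotonic if it is infinitely differentiable, $f\ge0$, and $(-1)^nf^{(n)}(x)\ge0$ for all $n\ge1$, $x>0$. A positive function $f$ on $(0,\infty)$ is logarithmically completely monotonic if $-(\log f)'$ is completely monotonic. *)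

theory Defs
  imports "HOL-Analysis.Analysis"
begin

text \<open>
  Functions on $(0,\infty)$ are represented by total functions on the reals; only their
  values at positive arguments matter, since \<^const>\<open>deriv\<close> at a point
  depends only on the values near that point. As \<^const>\<open>deriv\<close> is total, too,
  every use of it is guarded by an explicit differentiability condition.
\<close>

definition completely_monotonic :: "(real \<Rightarrow> real) \<Rightarrow> bool" where
  "completely_monotonic f \<longleftrightarrow>
     (\<forall>n. \<forall>x>0. (deriv ^^ n) f differentiable (at x)) \<and>
     (\<forall>x>0. f x \<ge> 0) \<and>
     (\<forall>n\<ge>1. \<forall>x>0. (- 1) ^ n * (deriv ^^ n) f x \<ge> 0)"

definition log_completely_monotonic :: "(real \<Rightarrow> real) \<Rightarrow> bool" where
  "log_completely_monotonic f \<longleftrightarrow>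
     (\<forall>x>0. f x > 0) \<and>
     (\<forall>x>0. (\<lambda>y. ln (f y)) differentiable (at x)) \<and>
     completely_monotonic (\<lambda>x. - deriv (\<lambda>y. ln (f y)) x)"

end

theory Submission
  imports Defs
begin

text \<open>
  If $S = \sum_i \alpha_i A_i = \sum_j \beta_j B_j$ is zero, then both products are empty,
  $V(x) = \theta^{-x}$ and $\theta \ge 1$. Otherwise let $c = \frac1S \sum_i \alpha_i a_i$ and
  let $\psi$ be the digamma function. Up to the sign $(-1)^n$, the $n$-th derivative of
  $-(\log V)' = \log\theta - \sum_i \alpha_i A_i\,\psi(A_i x + a_i) +
  \sum_j \beta_j B_j\,\psi(B_j x + b_j)$ is
  \[ [n = 0]\log\theta + \sum_i \alpha_i A_i^{n+1} G_n(A_i x + a_i)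
     - \sum_j \beta_j B_j^{n+1} G_n(B_j x + b_j), \qquad G_n = (-1)^{n+1}\psi^{(n)}, \]
  and it has to be shown nonnegative for every $n$ and every $x > 0$. The usual way is an integral
  representation of $\psi$, with Bernstein's theorem in the background. Here the inequality is
  proved pointwise instead, by comparing $G_n$ with the elementary function
  $\varphi_n = (-1)^n (-\log)^{(n)}$.

  The functional equation $\log\Gamma(z+1) - \log\Gamma(z) = \log z$, differentiated $n$ times and
  read through the mean value theorem, says that $\varphi_n(z)$ is a value of the decreasing
  function $G_n$ between $z$ and $z + 1$. Hence $G_n(z + 1) \le \varphi_n(z) \le G_n(z)$
  (\<open>signed_Polygamma_bounds\<close>). The lower bound $\varphi_n(z) \le G_n(z)$ is applied to the
  numerator, and the upper bound to the denominator, where the hypothesis on $b_j$, that is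
  $b_j - 1 \ge B_j c$, pays for the shift by one. As $\varphi_n$ is homogeneous of degree $-n$, with
  an additive $\log$ for $n = 0$, the numerator sum is at least
  $\sum_i \alpha_i A_i\,\varphi_n(x + a_i/A_i)$ and the denominator sum is at most
  $S\,\varphi_n(x + c)$, except that for $n = 0$ there are terms $\log A_i$ and $\log B_j$ besides.
  Now $x + c$ is the mean of the points $x + a_i/A_i$ with the weights $\alpha_i A_i/S$, and
  $\varphi_n$ is convex. So Jensen's inequality makes the difference nonnegative
  (\<open>weighted_signed_Polygamma_sum_le\<close>). The logarithms that are left over for $n = 0$ are
  dominated by $\log\theta$ exactly because of the hypothesis on the products
  (\<open>weighted_log_sum_le_ln\<close>).
\<close>

section \<open>Complete monotonicity from a sequence of derivatives\<close>

text \<open>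
  A closed form for all derivatives is only valid inside the open set. This suffices because
  \<^const>\<open>deriv\<close> is local: each step of the induction replaces the iterated derivative by the
  closed form on the whole set before differentiating once more.
\<close>

lemma higher_deriv_eq_on_open:
  fixes f :: "real \<Rightarrow> real" and g :: "nat \<Rightarrow> real \<Rightarrow> real"
  assumes "open S" "x \<in> S"
    and f: "\<And>x. x \<in> S \<Longrightarrow> f x = g 0 x"
    and g: "\<And>n x. x \<in> S \<Longrightarrow> (g n has_real_derivative g (Suc n) x) (at x)"
  shows "(deriv ^^ n) f x = g n x"
    and "((deriv ^^ n) f has_real_derivative g (Suc n) x) (at x)"
proof -
  have eq: "\<forall>x\<in>S. (deriv ^^ n) f x = g n x" for n
  proof (induction n)
    case (Suc n)
    have "((deriv ^^ n) f has_real_derivative g (Suc n) x) (at x)" if "x \<in> S" for x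
      using g[OF that] \<open>open S\<close> that
      by (rule has_field_derivative_transform_within_open) (use Suc.IH in auto)
    then show ?case
      by (auto intro!: DERIV_imp_deriv)
  qed (use f in auto)
  show "(deriv ^^ n) f x = g n x"
    using eq \<open>x \<in> S\<close> by blast
  show "((deriv ^^ n) f has_real_derivative g (Suc n) x) (at x)"
    using g[OF \<open>x \<in> S\<close>] \<open>open S\<close> \<open>x \<in> S\<close>
    by (rule has_field_derivative_transform_within_open) (use eq in auto)
qed

lemma completely_monotonicI:
  fixes f :: "real \<Rightarrow> real" and g :: "nat \<Rightarrow> real \<Rightarrow> real"
  assumes f: "\<And>x. x > 0 \<Longrightarrow> f x = g 0 x"
    and g: "\<And>n x. x > 0 \<Longrightarrow> (g n has_real_derivative g (Suc n) x) (at x)"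
    and sgn: "\<And>n x. x > 0 \<Longrightarrow> (- 1) ^ n * g n x \<ge> 0"
  shows "completely_monotonic f"
proof -
  have D: "(deriv ^^ n) f x = g n x" "((deriv ^^ n) f has_real_derivative g (Suc n) x) (at x)"
    if "x > 0" for n x
    using higher_deriv_eq_on_open[of "{0<..}" x f g n] that f g by auto
  show ?thesis
    unfolding completely_monotonic_def
    using D sgn sgn[where n = 0] f by (fastforce simp: real_differentiable_def)
qed

section \<open>The signed derivatives of the negated logarithm\<close>

text \<open>
  This is $(-1)^n$ times the $n$-th derivative of $-\log$. The sign makes $n = 0$ the first member of
  one family, so that every inequality below covers the digamma function and its derivatives at once.
\<close>

definition neg_ln_deriv :: "nat \<Rightarrow> real \<Rightarrow> real" where
  "neg_ln_deriv n y = (if n = 0 then - ln y else fact (n - 1) / y ^ n)"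

lemma has_field_derivative_neg_ln_deriv:
  assumes "y > 0"
  shows "(neg_ln_deriv n has_real_derivative - neg_ln_deriv (Suc n) y) (at y)"
proof (cases n)
  case 0
  have "((\<lambda>y. - ln y) has_real_derivative - neg_ln_deriv (Suc n) y) (at y)"
    using assms 0 by (auto intro!: derivative_eq_intros simp: neg_ln_deriv_def)
  with 0 show ?thesis by (simp add: neg_ln_deriv_def[abs_def])
next
  case (Suc m)
  have "((\<lambda>y. y ^ Suc m) has_real_derivative real (Suc m) * y ^ m) (at y)"
    using DERIV_pow[of "Suc m" y] by simp
  from DERIV_divide[OF DERIV_const[of "fact m"] this]
  have "((\<lambda>y. fact m / y ^ Suc m) has_real_derivative
           - (fact m * (real (Suc m) * y ^ m)) / (y ^ Suc m * y ^ Suc m)) (at y)"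
    using assms by simp
  also have "- (fact m * (real (Suc m) * y ^ m)) / (y ^ Suc m * y ^ Suc m) = - neg_ln_deriv (Suc n) y"
    using assms Suc by (simp add: neg_ln_deriv_def field_simps)
  finally have "((\<lambda>y. fact m / y ^ Suc m) has_real_derivative - neg_ln_deriv (Suc n) y) (at y)" .
  with Suc show ?thesis by (simp add: neg_ln_deriv_def[abs_def])
qed

lemma neg_ln_deriv_Suc_nonneg: "y > 0 \<Longrightarrow> neg_ln_deriv (Suc n) y \<ge> 0"
  by (simp add: neg_ln_deriv_def)

lemma convex_on_neg_ln_deriv: "convex_on {0<..} (neg_ln_deriv n)"
proof (rule f''_ge0_imp_convex)
  fix y :: real assume "y \<in> {0<..}"
  then have y: "y > 0" by simp
  show "(neg_ln_deriv n has_real_derivative - neg_ln_deriv (Suc n) y) (at y)"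
    by (rule has_field_derivative_neg_ln_deriv[OF y])
  show "((\<lambda>y. - neg_ln_deriv (Suc n) y) has_real_derivative neg_ln_deriv (Suc (Suc n)) y) (at y)"
    using DERIV_minus[OF has_field_derivative_neg_ln_deriv[OF y]] by simp
  show "neg_ln_deriv (Suc (Suc n)) y \<ge> 0"
    by (rule neg_ln_deriv_Suc_nonneg[OF y])
qed simp

lemma neg_ln_deriv_antimono:
  assumes "0 < x" "x \<le> y"
  shows "neg_ln_deriv n y \<le> neg_ln_deriv n x"
  using assms by (auto simp: neg_ln_deriv_def intro!: divide_left_mono power_mono)

text \<open>
  Homogeneity turns values at $A x + a = A (x + a/A)$ into values at $x + a/A$. The factor $A^n$ is
  the one that the chain rule produces in the $n$-th derivative.
\<close>

lemma neg_ln_deriv_scale: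
  assumes "A > 0" "y > 0"
  shows "A ^ n * neg_ln_deriv n (A * y) = neg_ln_deriv n y - (if n = 0 then ln A else 0)"
  using assms by (simp add: neg_ln_deriv_def ln_mult power_mult_distrib)

section \<open>Bounds for the polygamma functions\<close>

definition signed_Polygamma :: "nat \<Rightarrow> real \<Rightarrow> real" where
  "signed_Polygamma n z = (- 1) ^ Suc n * Polygamma n z"

lemma signed_Polygamma_antimono:
  assumes "0 < x" "x \<le> y"
  shows "signed_Polygamma n y \<le> signed_Polygamma n x"
proof (cases "even n")
  case True
  then show ?thesis
    using Polygamma_real_mono[OF assms] by (simp add: signed_Polygamma_def)
next
  case False
  then show ?thesis
    using Polygamma_real_strict_antimono[of x y n] assms
    by (cases "x = y") (auto simp: signed_Polygamma_def)
qed

lemma pos_not_nonpos_Int: "(x::real) > 0 \<Longrightarrow> x \<notin> \<int>\<^sub>\<le>\<^sub>0"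
  by (auto elim!: nonpos_Ints_cases)

text \<open>
  The function \<open>H\<close> below is an antiderivative of the negated signed polygamma function. Its increment
  from $z$ to $z + 1$ is known exactly from the functional equation of $\Gamma$, or from that of the
  polygamma function of one order less.
\<close>

lemma signed_Polygamma_mean_value:
  assumes "z > 0"
  obtains \<xi> where "z < \<xi>" "\<xi> < z + 1" "signed_Polygamma n \<xi> = neg_ln_deriv n z"
proof -
  define H where "H x = (if n = 0 then ln_Gamma x else (- 1) ^ n * Polygamma (n - 1) x)" for x :: real
  have H': "(H has_real_derivative - signed_Polygamma n x) (at x)" if "x > 0" for x
  proof (cases n)
    case 0
    then show ?thesis
      using has_field_derivative_ln_Gamma_real[OF that]
      by (simp add: H_def[abs_def] signed_Polygamma_def)
  next
    case (Suc m)
    then show ?thesis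
      using DERIV_cmult[OF has_field_derivative_Polygamma[OF pos_not_nonpos_Int[OF that], of m],
          of "(- 1) ^ n"]
      by (simp add: H_def[abs_def] signed_Polygamma_def)
  qed
  have step: "H (z + 1) - H z = - neg_ln_deriv n z"
  proof (cases n)
    case 0
    have "Gamma (z + 1) = z * Gamma z"
      using assms by (intro Gamma_plus1 pos_not_nonpos_Int)
    then show ?thesis
      using 0 assms Gamma_real_pos[OF assms]
      by (simp add: H_def neg_ln_deriv_def ln_Gamma_real_pos ln_mult less_imp_neq[symmetric])
  next
    case (Suc m)
    then show ?thesis
      using assms Polygamma_plus1[of z m]
      by (simp add: H_def neg_ln_deriv_def field_simps)
  qed
  obtain \<xi> where "z < \<xi>" "\<xi> < z + 1" "H (z + 1) - H z = (z + 1 - z) * - signed_Polygamma n \<xi>"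
    using MVT2[of z "z + 1" H "\<lambda>x. - signed_Polygamma n x"] H' assms by auto
  with step that show thesis by auto
qed

lemma signed_Polygamma_bounds:
  assumes "z > 0"
  shows "neg_ln_deriv n z \<le> signed_Polygamma n z"
    and "signed_Polygamma n (z + 1) \<le> neg_ln_deriv n z"
proof -
  obtain \<xi> where "z < \<xi>" "\<xi> < z + 1" "signed_Polygamma n \<xi> = neg_ln_deriv n z"
    using signed_Polygamma_mean_value[OF assms] .
  then show "neg_ln_deriv n z \<le> signed_Polygamma n z" "signed_Polygamma n (z + 1) \<le> neg_ln_deriv n z"
    using signed_Polygamma_antimono[of z \<xi> n] signed_Polygamma_antimono[of \<xi> "z + 1" n] assms
    by auto
qed

lemma scaled_signed_Polygamma_ge:
  assumes "A > 0" "a \<ge> 0" "x > 0"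
  shows "A ^ n * signed_Polygamma n (A * x + a)
           \<ge> neg_ln_deriv n (x + a / A) - (if n = 0 then ln A else 0)"
proof -
  have pos: "x + a / A > 0" using assms by (simp add: add_pos_nonneg)
  have eq: "A * (x + a / A) = A * x + a" using assms by (simp add: field_simps)
  have "neg_ln_deriv n (x + a / A) - (if n = 0 then ln A else 0) = A ^ n * neg_ln_deriv n (A * x + a)"
    using neg_ln_deriv_scale[OF assms(1) pos, of n] eq by simp
  also have "\<dots> \<le> A ^ n * signed_Polygamma n (A * x + a)"
    using assms by (intro mult_left_mono signed_Polygamma_bounds add_pos_nonneg) auto
  finally show ?thesis .
qed

text \<open>
  The upper bound only controls arguments that have been shifted by one. The condition on $b$ says
  that $B x + b \ge B (x + c) + 1$, with the same $c$ for all factors of the denominator.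
\<close>

lemma scaled_signed_Polygamma_le:
  assumes "B > 0" "c \<ge> 0" "x > 0" "B * c \<le> b - 1"
  shows "B ^ n * signed_Polygamma n (B * x + b)
           \<le> neg_ln_deriv n (x + c) - (if n = 0 then ln B else 0)"
proof -
  have pos: "B * (x + c) > 0" using assms by simp
  have "signed_Polygamma n (B * x + b) \<le> signed_Polygamma n (B * (x + c) + 1)"
    using assms pos by (intro signed_Polygamma_antimono) (auto simp: algebra_simps)
  also have "\<dots> \<le> neg_ln_deriv n (B * (x + c))"
    by (rule signed_Polygamma_bounds[OF pos])
  finally have "B ^ n * signed_Polygamma n (B * x + b) \<le> B ^ n * neg_ln_deriv n (B * (x + c))"
    using assms by (intro mult_left_mono) auto
  also have "\<dots> = neg_ln_deriv n (x + c) - (if n = 0 then ln B else 0)"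
    using assms by (intro neg_ln_deriv_scale) auto
  finally show ?thesis .
qed

section \<open>The comparison of weighted sums\<close>

lemma convex_on_sum_unnormalized:
  fixes f :: "real \<Rightarrow> real"
  assumes "finite I" "convex_on C f"
    and "\<And>i. i \<in> I \<Longrightarrow> w i \<ge> 0" "\<And>i. i \<in> I \<Longrightarrow> y i \<in> C" and W: "sum w I > 0"
  shows "sum w I * f ((\<Sum>i\<in>I. w i * y i) / sum w I) \<le> (\<Sum>i\<in>I. w i * f (y i))"
proof -
  have "I \<noteq> {}" using W by auto
  then have "f (\<Sum>i\<in>I. (w i / sum w I) *\<^sub>R y i) \<le> (\<Sum>i\<in>I. w i / sum w I * f (y i))"
    using assms by (intro convex_on_sum[of _ C]) (auto simp flip: sum_divide_distrib)
  then show ?thesis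
    using W by (simp add: field_simps flip: sum_divide_distrib)
qed

text \<open>
  Both sides are separated by the value of \<^const>\<open>neg_ln_deriv\<close> at $x + c$, weighted by
  $\sum_j \beta_j B_j$: the left side is below it term by term, and the right side is above it by
  Jensen's inequality. The additional sums for $n = 0$ undo the logarithmic terms of
  \<open>neg_ln_deriv_scale\<close>.
\<close>

lemma weighted_signed_Polygamma_sum_le:
  fixes A \<alpha> a :: "'i \<Rightarrow> real" and B \<beta> b :: "'j \<Rightarrow> real"
  assumes "finite I" "finite J"
    and A: "\<And>i. i \<in> I \<Longrightarrow> A i > 0" and \<alpha>: "\<And>i. i \<in> I \<Longrightarrow> \<alpha> i > 0" and a: "\<And>i. i \<in> I \<Longrightarrow> a i \<ge> 0"
    and B: "\<And>j. j \<in> J \<Longrightarrow> B j > 0" and \<beta>: "\<And>j. j \<in> J \<Longrightarrow> \<beta> j > 0"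
    and balance: "(\<Sum>i\<in>I. \<alpha> i * A i) = (\<Sum>j\<in>J. \<beta> j * B j)"
    and b: "\<And>j. j \<in> J \<Longrightarrow> (b j - 1) * (\<Sum>k\<in>J. \<beta> k * B k) \<ge> B j * (\<Sum>i\<in>I. \<alpha> i * a i)"
    and x: "x > 0"
  shows "(\<Sum>j\<in>J. \<beta> j * B j * (B j ^ n * signed_Polygamma n (B j * x + b j)))
           + (if n = 0 then \<Sum>j\<in>J. \<beta> j * B j * ln (B j) else 0)
       \<le> (\<Sum>i\<in>I. \<alpha> i * A i * (A i ^ n * signed_Polygamma n (A i * x + a i)))
           + (if n = 0 then \<Sum>i\<in>I. \<alpha> i * A i * ln (A i) else 0)"
proof (cases "J = {}")
  case True
  \<comment> \<open>The weights of \<open>I\<close> are positive, so by \<open>balance\<close> one family cannot be empty without the other.\<close>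
  have "I = {}"
  proof (rule ccontr)
    assume "I \<noteq> {}"
    then have "(\<Sum>i\<in>I. \<alpha> i * A i) > 0"
      using \<open>finite I\<close> A \<alpha> by (intro sum_pos) auto
    then show False using balance True by simp
  qed
  then show ?thesis using True by simp
next
  case False
  define S where "S = (\<Sum>j\<in>J. \<beta> j * B j)"
  define c where "c = (\<Sum>i\<in>I. \<alpha> i * a i) / S"
  have S: "S > 0"
    unfolding S_def using \<open>finite J\<close> False B \<beta> by (intro sum_pos) auto
  have c: "c \<ge> 0"
    unfolding c_def using S \<alpha> a by (intro divide_nonneg_pos sum_nonneg mult_nonneg_nonneg) (auto intro: less_imp_le)
  have bc: "B j * c \<le> b j - 1" if "j \<in> J" for j
    using b[OF that] S unfolding c_def S_def[symmetric] by (simp add: field_simps)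
  \<comment> \<open>This choice of \<open>c\<close> makes \<open>x + c\<close> the barycentre at which Jensen's inequality is applied.\<close>
  have mean: "(\<Sum>i\<in>I. \<alpha> i * A i * (x + a i / A i)) / S = x + c"
  proof -
    have "(\<Sum>i\<in>I. \<alpha> i * A i * (x + a i / A i)) = (\<Sum>i\<in>I. \<alpha> i * A i * x + \<alpha> i * a i)"
      using A by (intro sum.cong refl) (fastforce simp: field_simps)
    also have "\<dots> = S * x + (\<Sum>i\<in>I. \<alpha> i * a i)"
      using balance by (simp add: sum.distrib S_def flip: sum_distrib_right)
    finally show ?thesis using S by (simp add: c_def field_simps)
  qed
  have "(\<Sum>j\<in>J. \<beta> j * B j * (B j ^ n * signed_Polygamma n (B j * x + b j)))
           + (if n = 0 then \<Sum>j\<in>J. \<beta> j * B j * ln (B j) else 0)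
        = (\<Sum>j\<in>J. \<beta> j * B j * (B j ^ n * signed_Polygamma n (B j * x + b j) + (if n = 0 then ln (B j) else 0)))"
    by (simp add: distrib_left sum.distrib)
  also have "\<dots> \<le> (\<Sum>j\<in>J. \<beta> j * B j * neg_ln_deriv n (x + c))"
  proof (intro sum_mono mult_left_mono)
    fix j assume j: "j \<in> J"
    show "B j ^ n * signed_Polygamma n (B j * x + b j) + (if n = 0 then ln (B j) else 0)
            \<le> neg_ln_deriv n (x + c)"
      using scaled_signed_Polygamma_le[OF B[OF j] c x bc[OF j], of n] by linarith
    show "0 \<le> \<beta> j * B j" using B[OF j] \<beta>[OF j] by simp
  qed
  also have "\<dots> = S * neg_ln_deriv n (x + c)"
    by (simp add: S_def flip: sum_distrib_right)
  also have "\<dots> \<le> (\<Sum>i\<in>I. \<alpha> i * A i * neg_ln_deriv n (x + a i / A i))"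
  proof -
    have "\<And>i. i \<in> I \<Longrightarrow> x + a i / A i \<in> {0<..}"
      using x A a by (simp add: add_pos_nonneg less_imp_le)
    then show ?thesis
      using convex_on_sum_unnormalized[OF \<open>finite I\<close> convex_on_neg_ln_deriv,
          of "\<lambda>i. \<alpha> i * A i" "\<lambda>i. x + a i / A i" n] S A \<alpha> mean balance
      unfolding S_def[symmetric] by (simp add: less_imp_le)
  qed
  also have "\<dots> \<le> (\<Sum>i\<in>I. \<alpha> i * A i * (A i ^ n * signed_Polygamma n (A i * x + a i) + (if n = 0 then ln (A i) else 0)))"
  proof (intro sum_mono mult_left_mono)
    fix i assume i: "i \<in> I"
    show "neg_ln_deriv n (x + a i / A i)
            \<le> A i ^ n * signed_Polygamma n (A i * x + a i) + (if n = 0 then ln (A i) else 0)"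
      using scaled_signed_Polygamma_ge[OF A[OF i] a[OF i] x, of n] by linarith
    show "0 \<le> \<alpha> i * A i" using A[OF i] \<alpha>[OF i] by simp
  qed
  also have "\<dots> = (\<Sum>i\<in>I. \<alpha> i * A i * (A i ^ n * signed_Polygamma n (A i * x + a i)))
           + (if n = 0 then \<Sum>i\<in>I. \<alpha> i * A i * ln (A i) else 0)"
    by (simp add: distrib_left sum.distrib)
  finally show ?thesis .
qed

section \<open>Logarithmic complete monotonicity of the gamma quotient\<close>

lemma ln_Gamma_quotient:
  fixes A \<alpha> a :: "'i \<Rightarrow> real" and B \<beta> b :: "'j \<Rightarrow> real"
  assumes "\<theta> > 0" "finite I" "finite J"
    and "\<And>i. i \<in> I \<Longrightarrow> A i * x + a i > 0" "\<And>j. j \<in> J \<Longrightarrow> B j * x + b j > 0"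
  shows "\<theta> powr (- x) * ((\<Prod>i\<in>I. Gamma (A i * x + a i) powr \<alpha> i) /
                 (\<Prod>j\<in>J. Gamma (B j * x + b j) powr \<beta> j)) > 0" (is "?V > 0")
    and "ln (\<theta> powr (- x) * ((\<Prod>i\<in>I. Gamma (A i * x + a i) powr \<alpha> i) /
                 (\<Prod>j\<in>J. Gamma (B j * x + b j) powr \<beta> j)))
         = - x * ln \<theta> + (\<Sum>i\<in>I. \<alpha> i * ln_Gamma (A i * x + a i))
                      - (\<Sum>j\<in>J. \<beta> j * ln_Gamma (B j * x + b j))"
proof -
  have posA: "Gamma (A i * x + a i) > 0" if "i \<in> I" for i using assms(4)[OF that] by simp
  have posB: "Gamma (B j * x + b j) > 0" if "j \<in> J" for j using assms(5)[OF that] by simp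
  have num: "(\<Prod>i\<in>I. Gamma (A i * x + a i) powr \<alpha> i) > 0"
    using posA by (intro prod_pos) (auto simp: less_imp_neq[symmetric])
  have den: "(\<Prod>j\<in>J. Gamma (B j * x + b j) powr \<beta> j) > 0"
    using posB by (intro prod_pos) (auto simp: less_imp_neq[symmetric])
  show "?V > 0" using num den assms(1) by simp
  have "ln (\<Prod>i\<in>I. Gamma (A i * x + a i) powr \<alpha> i) = (\<Sum>i\<in>I. \<alpha> i * ln_Gamma (A i * x + a i))"
    using posA assms(2,4) by (subst ln_prod) (auto simp: less_imp_neq[symmetric] ln_powr ln_Gamma_real_pos intro!: sum.cong)
  moreover have "ln (\<Prod>j\<in>J. Gamma (B j * x + b j) powr \<beta> j) = (\<Sum>j\<in>J. \<beta> j * ln_Gamma (B j * x + b j))"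
    using posB assms(3,5) by (subst ln_prod) (auto simp: less_imp_neq[symmetric] ln_powr ln_Gamma_real_pos intro!: sum.cong)
  ultimately show "ln ?V = - x * ln \<theta> + (\<Sum>i\<in>I. \<alpha> i * ln_Gamma (A i * x + a i))
                      - (\<Sum>j\<in>J. \<beta> j * ln_Gamma (B j * x + b j))"
    using num den assms(1) by (simp add: ln_mult ln_div ln_powr)
qed

lemma weighted_log_sum_le_ln:
  fixes A \<alpha> :: "'i \<Rightarrow> real" and B \<beta> :: "'j \<Rightarrow> real"
  assumes "finite I" "finite J" "\<And>i. i \<in> I \<Longrightarrow> A i > 0" "\<And>j. j \<in> J \<Longrightarrow> B j > 0"
    and "(\<Prod>i\<in>I. A i powr (\<alpha> i * A i)) * (\<Prod>j\<in>J. B j powr (- (\<beta> j * B j))) \<le> \<theta>"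
  shows "(\<Sum>i\<in>I. \<alpha> i * A i * ln (A i)) - (\<Sum>j\<in>J. \<beta> j * B j * ln (B j)) \<le> ln \<theta>"
proof -
  have A: "(\<Prod>i\<in>I. A i powr (\<alpha> i * A i)) > 0"
    using assms(3) by (intro prod_pos) (auto simp: less_imp_neq[symmetric])
  have B: "(\<Prod>j\<in>J. B j powr (- (\<beta> j * B j))) > 0"
    using assms(4) by (intro prod_pos) (auto simp: less_imp_neq[symmetric])
  have "ln (\<Prod>i\<in>I. A i powr (\<alpha> i * A i)) = (\<Sum>i\<in>I. \<alpha> i * A i * ln (A i))"
    using assms(1,3) by (subst ln_prod) (auto simp: less_imp_neq[symmetric] ln_powr intro!: sum.cong)
  moreover have "ln (\<Prod>j\<in>J. B j powr (- (\<beta> j * B j))) = - (\<Sum>j\<in>J. \<beta> j * B j * ln (B j))"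
    using assms(2,4) by (subst ln_prod) (auto simp: less_imp_neq[symmetric] ln_powr sum_negf[symmetric] intro!: sum.cong)
  moreover have "ln ((\<Prod>i\<in>I. A i powr (\<alpha> i * A i)) * (\<Prod>j\<in>J. B j powr (- (\<beta> j * B j)))) \<le> ln \<theta>"
    using assms(5) A B by (intro ln_mono) auto
  ultimately show ?thesis using A B by (simp add: ln_mult)
qed

theorem corollary3p9:
  fixes \<theta> :: real and p s :: nat
    and A \<alpha> a B \<beta> b :: "nat \<Rightarrow> real"
  assumes "\<theta> > 0"
    and "\<And>i. i \<in> {1..p} \<Longrightarrow> A i > 0"
    and "\<And>i. i \<in> {1..p} \<Longrightarrow> \<alpha> i > 0"
    and "\<And>i. i \<in> {1..p} \<Longrightarrow> a i \<ge> 0"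
    and "\<And>j. j \<in> {1..s} \<Longrightarrow> B j > 0"
    and "\<And>j. j \<in> {1..s} \<Longrightarrow> \<beta> j > 0"
    and "\<And>j. j \<in> {1..s} \<Longrightarrow> b j \<ge> 0"
    and "(\<Sum>i=1..p. \<alpha> i * A i) = (\<Sum>j=1..s. \<beta> j * B j)"
    and "(\<Prod>i=1..p. A i powr (\<alpha> i * A i)) * (\<Prod>j=1..s. B j powr (- (\<beta> j * B j))) \<le> \<theta>"
    and "\<And>j. j \<in> {1..s} \<Longrightarrow>
           (b j - 1) * (\<Sum>k=1..s. \<beta> k * B k) \<ge> B j * (\<Sum>i=1..p. \<alpha> i * a i)"
  shows "log_completely_monotonic
           (\<lambda>x. \<theta> powr (- x) *
                ((\<Prod>i=1..p. Gamma (A i * x + a i) powr \<alpha> i) /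
                 (\<Prod>j=1..s. Gamma (B j * x + b j) powr \<beta> j)))"
proof -
  let ?I = "{1..p}" and ?J = "{1..s}"
  let ?V = "\<lambda>x. \<theta> powr (- x) *
                ((\<Prod>i=1..p. Gamma (A i * x + a i) powr \<alpha> i) /
                 (\<Prod>j=1..s. Gamma (B j * x + b j) powr \<beta> j))"
  define L where "L x = - x * ln \<theta> + (\<Sum>i\<in>?I. \<alpha> i * ln_Gamma (A i * x + a i))
                      - (\<Sum>j\<in>?J. \<beta> j * ln_Gamma (B j * x + b j))" for x
  \<comment> \<open>\<open>g n\<close> is the \<open>n\<close>-th derivative of \<open>- L'\<close>; the Polygamma function of order 0 is the digamma function.\<close>
  define g where "g n x = (if n = 0 then ln \<theta> else 0)
      - (\<Sum>i\<in>?I. \<alpha> i * A i * (A i ^ n * Polygamma n (A i * x + a i)))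
      + (\<Sum>j\<in>?J. \<beta> j * B j * (B j ^ n * Polygamma n (B j * x + b j)))" for n x
  have posA: "A i * x + a i > 0" if "i \<in> ?I" "x > 0" for i x
    using assms(2)[OF that(1)] assms(4)[OF that(1)] that(2) by (intro add_pos_nonneg) auto
  have posB: "B j * x + b j > 0" if "j \<in> ?J" "x > 0" for j x
    using assms(5)[OF that(1)] assms(7)[OF that(1)] that(2) by (intro add_pos_nonneg) auto
  have V: "?V x > 0" "ln (?V x) = L x" if "x > 0" for x
    unfolding L_def using ln_Gamma_quotient[of \<theta> ?I ?J A x a B b] assms(1) posA posB that by auto
  have L': "(L has_real_derivative - g 0 x) (at x)" if x: "x > 0" for x
    unfolding L_def[abs_def] g_def
    by (rule derivative_eq_intros refl posA posB x | assumption)+ (simp add: mult_ac)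
  have lnV': "((\<lambda>y. ln (?V y)) has_real_derivative - g 0 x) (at x)" if x: "x > 0" for x
    by (rule has_field_derivative_transform_within_open[OF L'[OF x], of "{0<..}"]) (use x V in auto)
  have g': "(g n has_real_derivative g (Suc n) x) (at x)" if x: "x > 0" for n x
    unfolding g_def[abs_def]
    by (rule derivative_eq_intros refl pos_not_nonpos_Int posA posB x | assumption)+ (simp add: mult_ac)
  have sgn: "(- 1) ^ n * g n x \<ge> 0" if x: "x > 0" for n x
  proof -
    have "(- 1) ^ n * g n x = (if n = 0 then ln \<theta> else 0)
      + (\<Sum>i\<in>?I. \<alpha> i * A i * (A i ^ n * signed_Polygamma n (A i * x + a i)))
      - (\<Sum>j\<in>?J. \<beta> j * B j * (B j ^ n * signed_Polygamma n (B j * x + b j)))"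
      by (simp add: g_def signed_Polygamma_def algebra_simps sum_distrib_left sum_negf)
    then show ?thesis
      using weighted_signed_Polygamma_sum_le[of ?I ?J A \<alpha> a B \<beta> b x n] assms x
        weighted_log_sum_le_ln[of ?I ?J A B \<alpha> \<beta> \<theta>]
      by (cases "n = 0") auto
  qed
  have "completely_monotonic (\<lambda>x. - deriv (\<lambda>y. ln (?V y)) x)"
    by (rule completely_monotonicI[of _ g]) (use DERIV_imp_deriv[OF lnV'] g' sgn in auto)
  then show ?thesis
    unfolding log_completely_monotonic_def using V lnV' by (auto simp: real_differentiable_def)
qed

end
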